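(* Assume $N\ge1$, $k\ge0$, $a>0$, $a+2\langle k\rangle+N>2$ and that either (i) $N=1$ and $a>0$, or (ii) $a\in\{1,2\}$. For every $f\in L^2_{k,a}(\mathbb{R}^N)$ with $\|f\|_{L^2_{k,a}}=1$ (such that the sum below is well-defined) it holds that \[\mathbb{E}(|f|^2)+\mathbb{E}(|\mathcal{F}_{k,a}f|^2)\ge 0 .\]
   Context: Let $\langle\cdot,\cdot\rangle$, $\|\cdot\|$ be the Euclidean inner product and norm on $\mathbb{R}^N$. Let $\mathcal{R}\subset\mathbb{R}^N\setminus\{0\}$ be a reduced root system with positive subsystem $\mathcal{R}^+$, let $r_\alpha(x)=x-2\frac{\langle\alpha,x\rangle}{\|\alpha\|^2}\alpha$, let $\mathfrak{C}$ be the finite group generated by the $r_\alpha$, and let $k:\mathcal{R}\to[0,\infty)$, $\alpha\mapsto k_\alpha$, be a $\mathfrak{C}$-invariant (multiplicity) function; $\langle k\rangle=\sum_{\alpha\in\mathcal{R}^+}k_\alpha$. For $a>0$ put $\vartheta_k(x)=\prod_{\alpha\in\mathcal{R}^+}|\langle\alpha,x\rangle|^{2k_\alpha}$, $\vartheta_{k,a}(x)=\|x\|^{a-2}\vartheta_k(x)$, $d\mu_{k,a}(x)=\vartheta_{k,a}(x)\,dx$, $L^p_{k,a}(\mathbb{R}^N)=L^p(\mathbb{R}^N,\mu_{k,a})$. The Dunkl Laplacian is $\Delta_kf(x)=\Delta f(x)+\sum_{\alpha\in\mathcal{R}^+}k_\alpha\bigl(\frac{2\langle\nabla f(x),\alpha\rangle}{\langle\alpha,x\rangle}-\|\alpha\|^2\frac{f(x)-f(r_\alpha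 x)}{\langle\alpha,x\rangle^2}\bigr)$. If $a+2\langle k\rangle+N>2$, the $(k,a)$-generalized Fourier transform is the unitary operator on $L^2_{k,a}(\mathbb{R}^N)$ given by $\mathcal{F}_{k,a}=\exp\bigl[\frac{i\pi}{2a}(2\langle k\rangle+N+a-2)\bigr]\exp\bigl[\frac{i\pi}{2a}(\|x\|^{2-a}\Delta_k-\|x\|^a)\bigr]$. Equivalently, it is the unitary operator determined by $\mathcal{F}_{k,a}\Phi_{\ell}(p,\cdot)=e^{-i\pi(\ell+m/a)}\Phi_\ell(p,\cdot)$ for $\ell,m\in\{0,1,2,\dots\}$ and $p$ a homogeneous polynomial of degree $m$ with $\Delta_kp=0$, where $\Phi_\ell(p,x)=p(x)L_\ell^{(\lambda_m)}(\frac2a\|x\|^a)e^{-\|x\|^a/a}$, $\lambda_m=\frac1a(2m+2\langle k\rangle+N-2)$, and $L_\ell^{(\lambda)}$ are Laguerre polynomials (these functions span a dense subspace). Standing normalization: $\mathcal{F}_{k,a}$ is unitary on $L^2_{k,a}(\mathbb{R}^N)$ and satisfies $\|\mathcal{F}_{k,a}f\|_\infty\le\|f\|_{L^1_{k,a}}$ for all $f\in L^1_{k,a}\cap L^2_{k,a}$. The entropy of a measurable function $h$ is $\mathbb{E}(h)=-\int_{\mathbb{R}^N}\ln(|h(x)|)\,|h(x)|\,d\mu_{k,a}(x)$ (with $0\ln0=0$), defined in $[-\infty,\infty]$ whenever the positive or the negative part of the integrand has finite integral. The sum of the two entropies is well-defined if both are defined and they are not infinite of opposite signs. *)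

theory Defs
  imports "HOL-Analysis.Analysis" "HOL-Probability.Essential_Supremum"
begin

section \<open>Root systems\<close>

definition reflection :: "'a::euclidean_space \<Rightarrow> 'a \<Rightarrow> 'a" where
  "reflection \<alpha> x = x - (2 * (\<alpha> \<bullet> x) / (norm \<alpha>)\<^sup>2) *\<^sub>R \<alpha>"

text \<open>As usual in Dunkl theory, a root system need be neither crystallographic nor spanning
  (so the empty set is allowed).\<close>

definition reduced_root_system :: "'a::euclidean_space set \<Rightarrow> bool" where
  "reduced_root_system R \<longleftrightarrow>
     finite R \<and> 0 \<notin> R \<and>
     (\<forall>\<alpha>\<in>R. reflection \<alpha> ` R = R) \<and>
     (\<forall>\<alpha>\<in>R. R \<inter> range (\<lambda>c::real. c *\<^sub>R \<alpha>) = {\<alpha>, - \<alpha>})"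

definition positive_subsystem :: "'a::euclidean_space set \<Rightarrow> 'a set \<Rightarrow> bool" where
  "positive_subsystem R P \<longleftrightarrow>
     (\<exists>\<beta>. (\<forall>\<alpha>\<in>R. \<beta> \<bullet> \<alpha> \<noteq> 0) \<and> P = {\<alpha>\<in>R. \<beta> \<bullet> \<alpha> > 0})"

text \<open>Reflections are involutions, so closure under composition already yields the generated
  group; no separate rule for inverses is needed.\<close>

inductive_set reflection_group :: "'a::euclidean_space set \<Rightarrow> ('a \<Rightarrow> 'a) set"
  for R :: "'a set" where
  id: "id \<in> reflection_group R"
| step: "\<alpha> \<in> R \<Longrightarrow> g \<in> reflection_group R \<Longrightarrow> reflection \<alpha> \<circ> g \<in> reflection_group R"

text \<open>Only the values of \<open>k\<close> on \<open>R\<close> are relevant, here and below.\<close>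

definition multiplicity_function :: "'a::euclidean_space set \<Rightarrow> ('a \<Rightarrow> real) \<Rightarrow> bool" where
  "multiplicity_function R k \<longleftrightarrow>
     (\<forall>\<alpha>\<in>R. 0 \<le> k \<alpha>) \<and> (\<forall>g\<in>reflection_group R. \<forall>\<alpha>\<in>R. k (g \<alpha>) = k \<alpha>)"

definition k_index :: "'a set \<Rightarrow> ('a \<Rightarrow> real) \<Rightarrow> real" where
  "k_index P k = (\<Sum>\<alpha>\<in>P. k \<alpha>)"


section \<open>The weighted measure and the spaces of integrable functions\<close>

text \<open>Where a base vanishes, \<open>powr\<close> gives \<open>0\<close> for every exponent, including \<open>0\<close> and negative ones.
  This affects the weight only at the origin and on the root hyperplanes, a Lebesgue null set.\<close>

definition dunkl_weight :: "'a::euclidean_space set \<Rightarrow> ('a \<Rightarrow> real) \<Rightarrow> 'a \<Rightarrow> real" where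
  "dunkl_weight P k x = (\<Prod>\<alpha>\<in>P. \<bar>\<alpha> \<bullet> x\<bar> powr (2 * k \<alpha>))"

definition ka_weight :: "'a::euclidean_space set \<Rightarrow> ('a \<Rightarrow> real) \<Rightarrow> real \<Rightarrow> 'a \<Rightarrow> real" where
  "ka_weight P k a x = norm x powr (a - 2) * dunkl_weight P k x"

definition ka_measure :: "'a::euclidean_space set \<Rightarrow> ('a \<Rightarrow> real) \<Rightarrow> real \<Rightarrow> 'a measure" where
  "ka_measure P k a = density lborel (\<lambda>x. ennreal (ka_weight P k a x))"

text \<open>Elements of \<open>L\<^sup>p\<close> are represented by functions; equality in \<open>L\<^sup>p\<close> is equality
  almost everywhere.\<close>

definition Lp_space :: "real \<Rightarrow> 'a measure \<Rightarrow> ('a \<Rightarrow> complex) set" where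
  "Lp_space p M = {f \<in> borel_measurable M. integrable M (\<lambda>x. norm (f x) powr p)}"

definition Lp_norm :: "real \<Rightarrow> 'a measure \<Rightarrow> ('a \<Rightarrow> complex) \<Rightarrow> real" where
  "Lp_norm p M f = (LINT x|M. norm (f x) powr p) powr (1 / p)"

definition unitary_on_L2 :: "'a measure \<Rightarrow> (('a \<Rightarrow> complex) \<Rightarrow> ('a \<Rightarrow> complex)) \<Rightarrow> bool" where
  "unitary_on_L2 M U \<longleftrightarrow>
     (\<forall>f\<in>Lp_space 2 M. U f \<in> Lp_space 2 M) \<and>
     (\<forall>f\<in>Lp_space 2 M. \<forall>g\<in>Lp_space 2 M.
        (AE x in M. f x = g x) \<longrightarrow> (AE x in M. U f x = U g x)) \<and>
     (\<forall>f\<in>Lp_space 2 M. \<forall>g\<in>Lp_space 2 M. \<forall>c d.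
        AE x in M. U (\<lambda>y. c * f y + d * g y) x = c * U f x + d * U g x) \<and>
     (\<forall>f\<in>Lp_space 2 M. \<forall>g\<in>Lp_space 2 M.
        (LINT x|M. U f x * cnj (U g x)) = (LINT x|M. f x * cnj (g x))) \<and>
     (\<forall>g\<in>Lp_space 2 M. \<exists>f\<in>Lp_space 2 M. AE x in M. U f x = g x)"


section \<open>The Dunkl Laplacian\<close>

definition laplacian :: "('a::euclidean_space \<Rightarrow> complex) \<Rightarrow> 'a \<Rightarrow> complex" where
  "laplacian f x =
     (\<Sum>b\<in>Basis. frechet_derivative (\<lambda>y. frechet_derivative f (at y) b) (at x) b)"

text \<open>The term \<open>\<langle>\<nabla>f(x), \<alpha>\<rangle>\<close> is the derivative of \<open>f\<close> at \<open>x\<close> in direction \<open>\<alpha>\<close>. The expression is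
  meaningful only off the root hyperplanes.\<close>

definition dunkl_laplacian ::
    "'a::euclidean_space set \<Rightarrow> ('a \<Rightarrow> real) \<Rightarrow> ('a \<Rightarrow> complex) \<Rightarrow> 'a \<Rightarrow> complex" where
  "dunkl_laplacian P k f x = laplacian f x +
     (\<Sum>\<alpha>\<in>P. of_real (k \<alpha>) *
        (2 * frechet_derivative f (at x) \<alpha> / of_real (\<alpha> \<bullet> x)
         - of_real ((norm \<alpha>)\<^sup>2) * (f x - f (reflection \<alpha> x)) / of_real ((\<alpha> \<bullet> x)\<^sup>2)))"

text \<open>The Dunkl Laplacian of a polynomial \<open>p\<close> is again a polynomial, given by the above formula on
  the dense set where no \<open>\<langle>\<alpha>, x\<rangle>\<close> vanishes; hence \<open>\<Delta>\<^sub>k p = 0\<close> is tested exactly there (on the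
  hyperplanes the formula would read \<open>z / 0 = 0\<close>).\<close>

definition dunkl_harmonic ::
    "'a::euclidean_space set \<Rightarrow> ('a \<Rightarrow> real) \<Rightarrow> nat \<Rightarrow> ('a \<Rightarrow> complex) \<Rightarrow> bool" where
  "dunkl_harmonic P k m p \<longleftrightarrow>
     polynomial_function p \<and>
     (\<forall>c x. p (c *\<^sub>R x) = of_real (c ^ m) * p x) \<and>
     (\<forall>x. (\<forall>\<alpha>\<in>P. \<alpha> \<bullet> x \<noteq> 0) \<longrightarrow> dunkl_laplacian P k p x = 0)"


section \<open>The generalized Fourier transform\<close>

definition laguerre :: "nat \<Rightarrow> real \<Rightarrow> real \<Rightarrow> real" where
  "laguerre l \<mu> t =
     (\<Sum>j\<le>l. (-1) ^ j * ((real l + \<mu>) gchoose (l - j)) * t ^ j / fact j)"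

definition ka_lambda :: "'a::euclidean_space set \<Rightarrow> ('a \<Rightarrow> real) \<Rightarrow> real \<Rightarrow> nat \<Rightarrow> real" where
  "ka_lambda P k a m = (2 * real m + 2 * k_index P k + real DIM('a) - 2) / a"

definition ka_Phi ::
    "'a::euclidean_space set \<Rightarrow> ('a \<Rightarrow> real) \<Rightarrow> real \<Rightarrow> nat \<Rightarrow> nat \<Rightarrow> ('a \<Rightarrow> complex) \<Rightarrow> 'a \<Rightarrow> complex"
  where
  "ka_Phi P k a l m p x =
     p x * of_real (laguerre l (ka_lambda P k a m) (2 / a * norm x powr a)
                    * exp (- (norm x powr a) / a))"

text \<open>The functions \<open>\<Phi>\<^sub>l(p, \<cdot>)\<close> span a dense subspace of \<open>L\<^sup>2\<close>, so the transform is the unitary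
  operator having them as eigenfunctions, with the eigenvalues below; the predicate determines the
  operator on \<open>L\<^sup>2\<close> up to equality almost everywhere.\<close>

definition is_ka_fourier_transform ::
    "'a::euclidean_space set \<Rightarrow> ('a \<Rightarrow> real) \<Rightarrow> real \<Rightarrow> (('a \<Rightarrow> complex) \<Rightarrow> ('a \<Rightarrow> complex)) \<Rightarrow> bool"
  where
  "is_ka_fourier_transform P k a F \<longleftrightarrow>
     unitary_on_L2 (ka_measure P k a) F \<and>
     (\<forall>l m p. dunkl_harmonic P k m p \<longrightarrow>
        (AE x in ka_measure P k a.
           F (ka_Phi P k a l m p) x
             = exp (- (\<i> * of_real (pi * (real l + real m / a)))) * ka_Phi P k a l m p x))"


section \<open>Entropy\<close>

text \<open>The integrand is \<open>- ln \<bar>h\<bar> \<cdot> \<bar>h\<bar>\<close>; \<open>ennreal\<close> truncates negative numbers to \<open>0\<close>, so the two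
  integrals below are those of its positive and of its negative part. The convention
  \<open>0 ln 0 = 0\<close> is built in.\<close>

definition entropy_pos :: "'a measure \<Rightarrow> ('a \<Rightarrow> real) \<Rightarrow> ennreal" where
  "entropy_pos M h = (\<integral>\<^sup>+x. ennreal (- (ln \<bar>h x\<bar> * \<bar>h x\<bar>)) \<partial>M)"

definition entropy_neg :: "'a measure \<Rightarrow> ('a \<Rightarrow> real) \<Rightarrow> ennreal" where
  "entropy_neg M h = (\<integral>\<^sup>+x. ennreal (ln \<bar>h x\<bar> * \<bar>h x\<bar>) \<partial>M)"

definition entropy_defined :: "'a measure \<Rightarrow> ('a \<Rightarrow> real) \<Rightarrow> bool" where
  "entropy_defined M h \<longleftrightarrow> entropy_pos M h < \<infinity> \<or> entropy_neg M h < \<infinity>"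

definition entropy :: "'a measure \<Rightarrow> ('a \<Rightarrow> real) \<Rightarrow> ereal" where
  "entropy M h = enn2ereal (entropy_pos M h) - enn2ereal (entropy_neg M h)"

definition entropy_sum_defined :: "'a measure \<Rightarrow> ('a \<Rightarrow> real) \<Rightarrow> ('a \<Rightarrow> real) \<Rightarrow> bool" where
  "entropy_sum_defined M g h \<longleftrightarrow>
     entropy_defined M g \<and> entropy_defined M h \<and>
     \<not> (entropy M g = \<infinity> \<and> entropy M h = -\<infinity>) \<and>
     \<not> (entropy M g = -\<infinity> \<and> entropy M h = \<infinity>)"

end

theory Submission
  imports Defs "HOL-Complex_Analysis.Complex_Analysis"
begin

text \<open>The argument uses only that \<open>U = \<F>\<^bsub>k,a\<^esub>\<close> is unitary on \<open>L\<^sup>2\<close> and contracts \<open>L\<^sup>1\<close> into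
  \<open>L\<^sup>\<infinity>\<close>. Put \<open>g = U f\<close> and let \<open>0 \<le> w \<le> \<bar>f\<bar>\<close> and \<open>0 \<le> v \<le> \<bar>g\<bar>\<close> be bounded. The pairing
  \<open>\<langle>U (w\<^sup>s f), v\<^sup>s g\<rangle>\<close> has modulus at most \<open>1\<close> for \<open>Re s = 0\<close> (unitarity) and for \<open>Re s = 1\<close> (there
  both functions have \<open>L\<^sup>1\<close>-norm at most \<open>1\<close>), hence on the whole strip by the three lines theorem.
  As \<open>s\<close> decreases to \<open>0\<close> it tends to \<open>\<parallel>g\<parallel>\<^sup>2 = 1\<close> with derivative \<open>\<integral> \<bar>f\<bar>\<^sup>2 ln w + \<integral> \<bar>g\<bar>\<^sup>2 ln v\<close>, which
  is therefore at most \<open>0\<close>. This is applied to \<open>w = min \<bar>f\<bar> C\<close>, \<open>v = min \<bar>g\<bar> C\<close>, and \<open>C\<close> tends to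
  infinity. Truncating only the weights keeps the pairing at \<open>s = 0\<close> equal to \<open>1\<close>, so that no
  integrability of \<open>f\<close> beyond \<open>L\<^sup>2\<close> is needed.\<close>

section \<open>Three lines theorem on the unit strip\<close>

text \<open>Multiplying by \<open>exp (\<epsilon> * (w\<^sup>2 - 1))\<close> leaves both vertical
  edges bounded by 1 and forces decay as the imaginary part grows. The maximum modulus principle
  then applies on a tall rectangle, and the factor disappears as \<epsilon> decreases to 0.\<close>

lemma three_lines_bound:
  fixes \<phi> :: "complex \<Rightarrow> complex"
  assumes hol: "\<phi> holomorphic_on {z. 0 < Re z \<and> Re z < 1}"
    and cont: "continuous_on {z. 0 \<le> Re z \<and> Re z \<le> 1} \<phi>"
    and bounded: "\<And>z. 0 \<le> Re z \<Longrightarrow> Re z \<le> 1 \<Longrightarrow> norm (\<phi> z) \<le> K"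
    and left: "\<And>z. Re z = 0 \<Longrightarrow> norm (\<phi> z) \<le> 1"
    and right: "\<And>z. Re z = 1 \<Longrightarrow> norm (\<phi> z) \<le> 1"
    and z: "0 \<le> Re z" "Re z \<le> 1"
  shows "norm (\<phi> z) \<le> 1"
proof -
  have K: "0 \<le> K" using bounded[OF z] norm_ge_zero order_trans by blast
  have step: "norm (\<phi> z) * exp (\<epsilon> * ((Re z)\<^sup>2 - (Im z)\<^sup>2 - 1)) \<le> 1" if \<epsilon>: "0 < \<epsilon>" for \<epsilon> :: real
  proof -
    define \<psi> where "\<psi> = (\<lambda>w. \<phi> w * exp (of_real \<epsilon> * (w\<^sup>2 - 1)))"
    have norm_\<psi>: "norm (\<psi> w) = norm (\<phi> w) * exp (\<epsilon> * ((Re w)\<^sup>2 - (Im w)\<^sup>2 - 1))" for w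
      by (simp add: \<psi>_def norm_mult power2_eq_square)
    \<comment> \<open>The height puts \<open>z\<close> inside the rectangle and ensures
      \<open>\<epsilon> * Y\<^sup>2 \<ge> K\<close>. On the horizontal edges the damping factor is
      then at most \<open>exp (- K)\<close>, and \<open>K * exp (- K) \<le> 1\<close>.\<close>
    define Y where "Y = \<bar>Im z\<bar> + 1 + K / \<epsilon>"
    have "K / \<epsilon> \<ge> 0" using K \<epsilon> by simp
    then have Y: "1 \<le> Y" "\<bar>Im z\<bar> \<le> Y" "K / \<epsilon> \<le> Y" by (auto simp: Y_def)
    have "K / \<epsilon> \<le> Y\<^sup>2" using Y by (smt (verit) power2_eq_square mult_left_mono mult_cancel_left1)
    then have KY: "K \<le> \<epsilon> * Y\<^sup>2" using \<epsilon> by (simp add: field_simps)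
    define S where "S = cbox (Complex 0 (-Y)) (Complex 1 Y)"
    have S: "w \<in> S \<longleftrightarrow> 0 \<le> Re w \<and> Re w \<le> 1 \<and> \<bar>Im w\<bar> \<le> Y" for w
      by (auto simp: S_def in_cbox_complex_iff)
    have "norm (\<psi> z) \<le> 1"
    proof (rule maximum_modulus_frontier[of \<psi> S])
      show "\<psi> holomorphic_on interior S"
        unfolding \<psi>_def S_def interior_cbox
        by (intro holomorphic_intros holomorphic_on_subset[OF hol]) (auto simp: in_box_complex_iff)
      have "closure S = S" by (simp add: S_def)
      then show "continuous_on (closure S) \<psi>"
        unfolding \<psi>_def
        by (intro continuous_intros continuous_on_subset[OF cont]) (auto simp: S)
      show "bounded S" by (simp add: S_def bounded_cbox)
      show "z \<in> S" using z Y by (simp add: S)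
      fix w assume "w \<in> frontier S"
      then have w: "0 \<le> Re w" "Re w \<le> 1" "\<bar>Im w\<bar> \<le> Y"
        and edge: "Re w = 0 \<or> Re w = 1 \<or> \<bar>Im w\<bar> = Y"
        by (auto simp: S_def frontier_cbox in_cbox_complex_iff in_box_complex_iff)
      have sq: "(Re w)\<^sup>2 \<le> 1" using w by (simp add: power_le_one)
      show "norm (\<psi> w) \<le> 1"
      proof (cases "\<bar>Im w\<bar> = Y")
        case True
        then have "(Im w)\<^sup>2 = Y\<^sup>2" by (metis power2_abs)
        then have "\<epsilon> * ((Re w)\<^sup>2 - (Im w)\<^sup>2 - 1) \<le> \<epsilon> * (- (Y\<^sup>2))"
          using sq \<epsilon> by (intro mult_left_mono) auto
        also have "\<dots> \<le> - K" using KY by simp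
        finally have "norm (\<psi> w) \<le> K * exp (- K)"
          unfolding norm_\<psi> using bounded[OF w(1,2)] K by (intro mult_mono) auto
        also have "\<dots> \<le> 1"
        proof -
          have "K \<le> exp K" using exp_ge_add_one_self[of K] by linarith
          then show ?thesis by (simp add: exp_minus divide_simps)
        qed
        finally show ?thesis .
      next
        case False
        then have "norm (\<phi> w) \<le> 1" using edge left right by blast
        moreover have "\<epsilon> * ((Re w)\<^sup>2 - (Im w)\<^sup>2 - 1) \<le> 0"
          using sq \<epsilon> zero_le_power2[of "Im w"] by (intro mult_nonneg_nonpos) linarith+
        ultimately show ?thesis unfolding norm_\<psi> by (intro mult_le_one) auto
      qed
    qed
    then show ?thesis by (simp add: norm_\<psi>)
  qed
  have lim: "((\<lambda>\<epsilon>. norm (\<phi> z) * exp (\<epsilon> * ((Re z)\<^sup>2 - (Im z)\<^sup>2 - 1)))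
          \<longlongrightarrow> norm (\<phi> z) * exp (0 * ((Re z)\<^sup>2 - (Im z)\<^sup>2 - 1))) (at_right 0)"
    by (intro tendsto_intros)
  have "norm (\<phi> z) * exp (0 * ((Re z)\<^sup>2 - (Im z)\<^sup>2 - 1)) \<le> 1"
    by (rule tendsto_upperbound[OF lim]) (auto simp: eventually_at_right_less step intro!: eventually_mono[OF eventually_at_right_less[of 0]])
  then show ?thesis by simp
qed

section \<open>Simple approximation and elementary facts on square integrable functions\<close>

text \<open>Approximating from below, everywhere and not just almost everywhere, keeps each
  approximant of \<open>min (norm (f x)) C\<close> an admissible weight for the pairing
  estimate.\<close>

lemma simple_function_approx_real:
  fixes u :: "'a \<Rightarrow> real"
  assumes "u \<in> borel_measurable M" and "\<And>x. 0 \<le> u x"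
  obtains w where "\<And>i. simple_function M (w i)" "\<And>i x. 0 \<le> w i x" "\<And>i x. w i x \<le> u x"
    "\<And>x. (\<lambda>i. w i x) \<longlonglongrightarrow> u x"
proof -
  obtain h where h: "\<And>i. simple_function M (h i)" "incseq h" "\<And>i x. h i x < top"
    "\<And>x. (SUP i. h i x) = ennreal (u x)"
    using borel_measurable_implies_simple_function_sequence'[of "\<lambda>x. ennreal (u x)" M] assms by auto
  have le: "h i x \<le> ennreal (u x)" for i x
    by (metis h(4) SUP_upper UNIV_I)
  have lim: "(\<lambda>i. h i x) \<longlonglongrightarrow> ennreal (u x)" for x
    using LIMSEQ_SUP[of "\<lambda>i. h i x"] h(2,4) by (auto simp: incseq_def le_fun_def)
  show thesis
  proof
    show "simple_function M (\<lambda>x. enn2real (h i x))" for i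
      using h(1) by (rule simple_function_compose1)
    show "enn2real (h i x) \<le> u x" for i x
      using le assms(2) by (intro enn2real_leI) auto
    show "(\<lambda>i. enn2real (h i x)) \<longlonglongrightarrow> u x" for x
      using tendsto_enn2real[OF lim] assms(2) by simp
  qed auto
qed

lemma Lp_space_2_iff:
  "f \<in> Lp_space 2 M \<longleftrightarrow> f \<in> borel_measurable M \<and> integrable M (\<lambda>x. (norm (f x))\<^sup>2)"
  by (simp add: Lp_space_def)

lemma Lp_space_1_iff: "f \<in> Lp_space 1 M \<longleftrightarrow> integrable M f"
  by (auto simp: Lp_space_def integrable_iff_bounded)

lemma Lp_space_2_mult_bounded:
  assumes "f \<in> Lp_space 2 M" and "b \<in> borel_measurable M" and "\<And>x. x \<in> space M \<Longrightarrow> norm (b x) \<le> C"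
  shows "(\<lambda>x. b x * f x) \<in> Lp_space 2 M"
proof -
  have "integrable M (\<lambda>x. (norm (b x * f x))\<^sup>2)"
  proof (rule Bochner_Integration.integrable_bound)
    show "integrable M (\<lambda>x. C\<^sup>2 * (norm (f x))\<^sup>2)" using assms by (simp add: Lp_space_2_iff)
    show "AE x in M. norm ((norm (b x * f x))\<^sup>2) \<le> norm (C\<^sup>2 * (norm (f x))\<^sup>2)"
      using assms(3) by (auto simp: norm_mult power_mult_distrib intro!: AE_I2 mult_right_mono power_mono)
  qed (use assms in \<open>auto simp: Lp_space_2_iff\<close>)
  then show ?thesis using assms by (auto simp: Lp_space_2_iff)
qed

lemma Lp_space_2_add:
  assumes "f \<in> Lp_space 2 M" and "g \<in> Lp_space 2 M"
  shows "(\<lambda>x. f x + g x) \<in> Lp_space 2 M"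
proof -
  have "integrable M (\<lambda>x. (norm (f x + g x))\<^sup>2)"
  proof (rule Bochner_Integration.integrable_bound)
    show "integrable M (\<lambda>x. 2 * (norm (f x))\<^sup>2 + 2 * (norm (g x))\<^sup>2)"
      using assms by (simp add: Lp_space_2_iff)
    have "(norm (f x + g x))\<^sup>2 \<le> 2 * (norm (f x))\<^sup>2 + 2 * (norm (g x))\<^sup>2" for x
    proof -
      have "(norm (f x + g x))\<^sup>2 \<le> (norm (f x) + norm (g x))\<^sup>2"
        by (intro power_mono norm_triangle_ineq) auto
      also have "\<dots> \<le> 2 * (norm (f x))\<^sup>2 + 2 * (norm (g x))\<^sup>2"
        using sum_squares_bound[of "norm (f x)" "norm (g x)"] by (simp add: power2_sum)
      finally show ?thesis .
    qed
    then show "AE x in M. norm ((norm (f x + g x))\<^sup>2) \<le> norm (2 * (norm (f x))\<^sup>2 + 2 * (norm (g x))\<^sup>2)"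
      by simp
  qed (use assms in \<open>auto simp: Lp_space_2_iff\<close>)
  then show ?thesis using assms by (auto simp: Lp_space_2_iff)
qed

lemma Lp_space_2_cmult: "f \<in> Lp_space 2 M \<Longrightarrow> (\<lambda>x. c * f x) \<in> Lp_space 2 M"
  by (rule Lp_space_2_mult_bounded[where C = "norm c"]) auto

lemma Lp_space_2_sum:
  assumes "finite C" and "\<And>c. c \<in> C \<Longrightarrow> f c \<in> Lp_space 2 M"
  shows "(\<lambda>x. \<Sum>c\<in>C. \<alpha> c * f c x) \<in> Lp_space 2 M"
  using assms
proof (induction C rule: finite_induct)
  case empty
  then show ?case by (simp add: Lp_space_2_iff)
next
  case (insert c C)
  then show ?case by (auto intro!: Lp_space_2_add Lp_space_2_cmult)
qed

lemma borel_measurable_cnj: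
  "f \<in> borel_measurable M \<Longrightarrow> (\<lambda>x. cnj (f x)) \<in> borel_measurable M"
  by (rule borel_measurable_continuous_on) (auto intro: continuous_intros)

lemma integrable_Lp_space_2_mult:
  assumes "f \<in> Lp_space 2 M" and "g \<in> Lp_space 2 M"
  shows "integrable M (\<lambda>x. f x * cnj (g x))"
proof (rule Bochner_Integration.integrable_bound)
  show "integrable M (\<lambda>x. ((norm (f x))\<^sup>2 + (norm (g x))\<^sup>2) / 2)"
    using assms by (simp add: Lp_space_2_iff)
  show "AE x in M. norm (f x * cnj (g x)) \<le> norm (((norm (f x))\<^sup>2 + (norm (g x))\<^sup>2) / 2)"
    by (auto simp: norm_mult field_simps intro!: AE_I2 order_trans[OF _ sum_squares_bound])
qed (use assms in \<open>auto simp: Lp_space_2_iff intro!: borel_measurable_times borel_measurable_cnj\<close>)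

text \<open>Integrate the pointwise bound of a product by the mean of the squares. Compared with
  Cauchy-Schwarz this gives the arithmetic instead of the geometric mean, which is just as good for
  norms at most 1 and for second-order error terms.\<close>

lemma norm_inner_le_half_squares:
  assumes f: "f \<in> Lp_space 2 M" and g: "g \<in> Lp_space 2 M"
  shows "norm (LINT x|M. f x * cnj (g x))
    \<le> ((LINT x|M. (norm (f x))\<^sup>2) + (LINT x|M. (norm (g x))\<^sup>2)) / 2"
proof -
  have "norm (LINT x|M. f x * cnj (g x)) \<le> (LINT x|M. norm (f x * cnj (g x)))"
    by (rule integral_norm_bound)
  also have "\<dots> \<le> (LINT x|M. ((norm (f x))\<^sup>2 + (norm (g x))\<^sup>2) / 2)"
  proof (rule integral_mono)
    show "integrable M (\<lambda>x. norm (f x * cnj (g x)))"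
      using integrable_Lp_space_2_mult[OF f g] by (rule integrable_norm)
    show "norm (f x * cnj (g x)) \<le> ((norm (f x))\<^sup>2 + (norm (g x))\<^sup>2) / 2" for x
      using sum_squares_bound[of "norm (f x)" "norm (g x)"] by (auto simp: norm_mult field_simps)
  qed (use f g in \<open>simp add: Lp_space_2_iff\<close>)
  also have "\<dots> = ((LINT x|M. (norm (f x))\<^sup>2) + (LINT x|M. (norm (g x))\<^sup>2)) / 2"
    using f g by (simp add: Lp_space_2_iff)
  finally show ?thesis .
qed

section \<open>Unitary operators that contract integrable functions into bounded ones\<close>

locale unitary_L1_contraction =
  fixes M :: "'a measure" and U :: "('a \<Rightarrow> complex) \<Rightarrow> 'a \<Rightarrow> complex"
  assumes unitary: "unitary_on_L2 M U"
    and bound: "\<And>h. h \<in> Lp_space 1 M \<Longrightarrow> h \<in> Lp_space 2 M \<Longrightarrow> AE x in M. norm (U h x) \<le> Lp_norm 1 M h"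
begin

lemma closed: "f \<in> Lp_space 2 M \<Longrightarrow> U f \<in> Lp_space 2 M"
  using unitary by (simp add: unitary_on_L2_def)

lemma linear:
  "f \<in> Lp_space 2 M \<Longrightarrow> g \<in> Lp_space 2 M \<Longrightarrow> AE x in M. U (\<lambda>y. c * f y + d * g y) x = c * U f x + d * U g x"
  using unitary unfolding unitary_on_L2_def by blast

lemma inner_eq:
  "f \<in> Lp_space 2 M \<Longrightarrow> g \<in> Lp_space 2 M \<Longrightarrow> (LINT x|M. U f x * cnj (U g x)) = (LINT x|M. f x * cnj (g x))"
  using unitary by (simp add: unitary_on_L2_def)

lemma norm_eq:
  assumes "f \<in> Lp_space 2 M"
  shows "(LINT x|M. (norm (U f x))\<^sup>2) = (LINT x|M. (norm (f x))\<^sup>2)"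
proof -
  have "complex_of_real (LINT x|M. (norm (U f x))\<^sup>2) = complex_of_real (LINT x|M. (norm (f x))\<^sup>2)"
    using inner_eq[OF assms assms]
    by (simp add: complex_norm_square flip: integral_complex_of_real del: of_real_power)
  then show ?thesis by (simp only: of_real_eq_iff)
qed

lemma linear_sum:
  assumes "finite C" and "\<And>c. c \<in> C \<Longrightarrow> f c \<in> Lp_space 2 M"
  shows "AE x in M. U (\<lambda>y. \<Sum>c\<in>C. \<alpha> c * f c y) x = (\<Sum>c\<in>C. \<alpha> c * U (f c) x)"
  using assms
proof (induction C rule: finite_induct)
  case empty
  \<comment> \<open>That \<open>U\<close> maps 0 to 0 almost everywhere is linearity with both
    coefficients equal to 0.\<close>
  have "(\<lambda>x. 0) \<in> Lp_space 2 M" by (simp add: Lp_space_2_iff)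
  from linear[OF this this, of 0 0] show ?case by simp
next
  case (insert c C)
  have "AE x in M. U (\<lambda>y. \<alpha> c * f c y + 1 * (\<Sum>c\<in>C. \<alpha> c * f c y)) x
      = \<alpha> c * U (f c) x + 1 * U (\<lambda>y. \<Sum>c\<in>C. \<alpha> c * f c y) x"
    using insert by (intro linear Lp_space_2_sum) auto
  moreover have "AE x in M. U (\<lambda>y. \<Sum>c\<in>C. \<alpha> c * f c y) x = (\<Sum>c\<in>C. \<alpha> c * U (f c) x)"
    using insert by auto
  ultimately show ?case by eventually_elim (use insert.hyps in simp)
qed

text \<open>This reduces the pairing of two finite combinations to a finite matrix of numbers, so
  that for simple weights all dependence on the complex exponent sits in the coefficients.\<close>

lemma inner_sum:
  assumes C: "finite C" "\<And>c. c \<in> C \<Longrightarrow> f c \<in> Lp_space 2 M"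
    and D: "finite D" "\<And>d. d \<in> D \<Longrightarrow> g d \<in> Lp_space 2 M"
  shows "(LINT x|M. U (\<lambda>y. \<Sum>c\<in>C. \<alpha> c * f c y) x * cnj (\<Sum>d\<in>D. \<beta> d * g d x))
    = (\<Sum>c\<in>C. \<Sum>d\<in>D. \<alpha> c * cnj (\<beta> d) * (LINT x|M. U (f c) x * cnj (g d x)))"
proof -
  have "(LINT x|M. U (\<lambda>y. \<Sum>c\<in>C. \<alpha> c * f c y) x * cnj (\<Sum>d\<in>D. \<beta> d * g d x))
    = (LINT x|M. (\<Sum>c\<in>C. \<alpha> c * U (f c) x) * cnj (\<Sum>d\<in>D. \<beta> d * g d x))"
  proof (rule integral_cong_AE)
    show "AE x in M. U (\<lambda>y. \<Sum>c\<in>C. \<alpha> c * f c y) x * cnj (\<Sum>d\<in>D. \<beta> d * g d x)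
        = (\<Sum>c\<in>C. \<alpha> c * U (f c) x) * cnj (\<Sum>d\<in>D. \<beta> d * g d x)"
    proof -
      have "AE x in M. U (\<lambda>y. \<Sum>c\<in>C. \<alpha> c * f c y) x = (\<Sum>c\<in>C. \<alpha> c * U (f c) x)"
        using C by (rule linear_sum)
      then show ?thesis by eventually_elim simp
    qed
    have [measurable]: "(\<lambda>x. cnj (\<Sum>d\<in>D. \<beta> d * g d x)) \<in> borel_measurable M"
      using Lp_space_2_sum[of D g M \<beta>] D by (intro borel_measurable_cnj) (simp add: Lp_space_2_iff)
    have [measurable]: "U (\<lambda>y. \<Sum>c\<in>C. \<alpha> c * f c y) \<in> borel_measurable M"
      using closed[OF Lp_space_2_sum[OF C]] by (simp add: Lp_space_2_iff)
    have [measurable]: "(\<lambda>x. \<Sum>c\<in>C. \<alpha> c * U (f c) x) \<in> borel_measurable M"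
      using Lp_space_2_sum[of C "\<lambda>c. U (f c)" M \<alpha>] C closed by (simp add: Lp_space_2_iff)
    show "(\<lambda>x. U (\<lambda>y. \<Sum>c\<in>C. \<alpha> c * f c y) x * cnj (\<Sum>d\<in>D. \<beta> d * g d x)) \<in> borel_measurable M"
      "(\<lambda>x. (\<Sum>c\<in>C. \<alpha> c * U (f c) x) * cnj (\<Sum>d\<in>D. \<beta> d * g d x)) \<in> borel_measurable M"
      by measurable
  qed
  also have "\<dots> = (LINT x|M. (\<Sum>c\<in>C. \<Sum>d\<in>D. (\<alpha> c * cnj (\<beta> d)) * (U (f c) x * cnj (g d x))))"
    by (simp add: sum_product mult_ac)
  also have "\<dots> = (\<Sum>c\<in>C. \<Sum>d\<in>D. \<alpha> c * cnj (\<beta> d) * (LINT x|M. U (f c) x * cnj (g d x)))"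
    using integrable_Lp_space_2_mult[OF closed[OF C(2)] D(2)]
    by (subst Bochner_Integration.integral_sum; simp add: Bochner_Integration.integral_sum)
  finally show ?thesis .
qed

end

section \<open>Simple multipliers and complex powers\<close>

lemma Lp_space_2_mult_simple:
  fixes b :: "'a \<Rightarrow> complex"
  assumes f: "f \<in> Lp_space 2 M" and b: "simple_function M b"
  shows "(\<lambda>x. b x * f x) \<in> Lp_space 2 M"
proof -
  have "finite ((\<lambda>x. norm (b x)) ` space M)"
    using b by (simp add: simple_function_def image_image[symmetric, of norm b])
  then show ?thesis
    using f borel_measurable_simple_function[OF b]
    by (intro Lp_space_2_mult_bounded[where C = "Max ((\<lambda>x. norm (b x)) ` space M)"]) auto
qed

lemma Lp_space_2_mult_simple_compose:
  "f \<in> Lp_space 2 M \<Longrightarrow> simple_function M w \<Longrightarrow> (\<lambda>x. complex_of_real (b (w x)) * f x) \<in> Lp_space 2 M"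
  by (rule Lp_space_2_mult_simple) (auto intro: simple_function_compose1)

lemma integrable_norm_square_mult_simple:
  fixes b :: "'b \<Rightarrow> real"
  assumes "f \<in> Lp_space 2 M" and "simple_function M w"
  shows "integrable M (\<lambda>x. (norm (f x))\<^sup>2 * b (w x))"
proof -
  have "integrable M (\<lambda>x. complex_of_real ((norm (f x))\<^sup>2 * b (w x)))"
    using integrable_Lp_space_2_mult[OF Lp_space_2_mult_simple_compose[OF assms] assms(1), of b]
    by (simp add: complex_norm_square mult_ac del: of_real_power)
  then show ?thesis by (simp only: complex_of_real_integrable_eq)
qed

lemma norm_of_real_powr: "0 \<le> c \<Longrightarrow> norm (complex_of_real c powr z) = c powr Re z"
  by (simp add: norm_powr_real_powr)

lemma cnj_of_real_powr: "0 \<le> c \<Longrightarrow> cnj (complex_of_real c powr cnj z) = complex_of_real c powr z"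
  by (simp add: cnj_powr)

text \<open>Base 0 is separate because \<open>0 powr z\<close> is 0 for every \<open>z\<close>,
  including \<open>z = 0\<close>; for any other base the power is an exponential in
  \<open>z\<close>.\<close>

lemma holomorphic_of_real_powr: "(\<lambda>z. complex_of_real c powr z) holomorphic_on A"
  by (cases "c = 0") (auto intro!: holomorphic_intros)

lemma simple_function_of_real_powr:
  "simple_function M w \<Longrightarrow> simple_function M (\<lambda>x. complex_of_real (w x) powr z)"
  by (rule simple_function_compose1)

section \<open>Interpolation of the weighted pairing\<close>

context unitary_L1_contraction
begin

text \<open>Level-set decompositions hold only on \<open>space M\<close>, so the arguments of
  \<open>U\<close> need not be equal as functions; that \<open>U\<close> respects almost everywhere
  equality bridges the gap.\<close>

lemma inner_cong:
  assumes f: "f \<in> Lp_space 2 M" "f' \<in> Lp_space 2 M" and g: "g \<in> Lp_space 2 M" "g' \<in> Lp_space 2 M"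
    and eq: "\<And>x. x \<in> space M \<Longrightarrow> f x = f' x" "\<And>x. x \<in> space M \<Longrightarrow> g x = g' x"
  shows "(LINT x|M. U f x * cnj (g x)) = (LINT x|M. U f' x * cnj (g' x))"
proof (rule integral_cong_AE)
  have "AE x in M. U f x = U f' x"
    using unitary f eq unfolding unitary_on_L2_def by (metis (mono_tags, lifting) AE_I2)
  then show "AE x in M. U f x * cnj (g x) = U f' x * cnj (g' x)"
    using AE_space by eventually_elim (simp add: eq)
qed (use closed f g in \<open>auto simp: Lp_space_2_iff intro!: borel_measurable_times borel_measurable_cnj\<close>)

text \<open>The contraction bounds \<open>U f\<close> by 1 almost everywhere, so the pairing is at
  most the integral of \<open>norm (g x)\<close>.\<close>

lemma norm_inner_le_1_of_L1:
  assumes f: "f \<in> Lp_space 2 M" "integrable M f" "(LINT x|M. norm (f x)) \<le> 1"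
    and g: "g \<in> Lp_space 2 M" "integrable M g" "(LINT x|M. norm (g x)) \<le> 1"
  shows "norm (LINT x|M. U f x * cnj (g x)) \<le> 1"
proof -
  have "AE x in M. norm (U f x) \<le> 1"
    using bound[of f] f by (auto simp: Lp_space_1_iff Lp_norm_def elim!: AE_mp)
  then have "AE x in M. norm (U f x * cnj (g x)) \<le> norm (g x)"
    by eventually_elim (simp add: norm_mult mult_left_le_one_le)
  then have "(LINT x|M. norm (U f x * cnj (g x))) \<le> (LINT x|M. norm (g x))"
    using integrable_Lp_space_2_mult[OF closed[OF f(1)] g(1)] g
    by (intro integral_mono_AE) auto
  then show ?thesis
    using integral_norm_bound[of M "\<lambda>x. U f x * cnj (g x)"] g(3) by linarith
qed

lemma norm_inner_le_1_of_L2: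
  assumes f: "f \<in> Lp_space 2 M" "(LINT x|M. (norm (f x))\<^sup>2) \<le> 1"
    and g: "g \<in> Lp_space 2 M" "(LINT x|M. (norm (g x))\<^sup>2) \<le> 1"
  shows "norm (LINT x|M. U f x * cnj (g x)) \<le> 1"
  using norm_inner_le_half_squares[OF closed[OF f(1)] g(1)] norm_eq[OF f(1)] f g by simp

text \<open>Simple weights turn the pairing into a finite sum of exponentials in \<open>z\<close>.
  Holomorphy and boundedness on the strip can then be read off, with no differentiation under the
  integral or inside \<open>U\<close>.\<close>

lemma interpolated_pairing:
  fixes w v :: "'a \<Rightarrow> real"
  assumes f: "f \<in> Lp_space 2 M" "(LINT x|M. (norm (f x))\<^sup>2) \<le> 1"
    and g: "g \<in> Lp_space 2 M" "(LINT x|M. (norm (g x))\<^sup>2) \<le> 1"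
    and w: "simple_function M w" "\<And>x. 0 \<le> w x" "\<And>x. w x \<le> norm (f x)"
    and v: "simple_function M v" "\<And>x. 0 \<le> v x" "\<And>x. v x \<le> norm (g x)"
    and s: "0 \<le> s" "s \<le> 1"
  shows "norm (LINT x|M. U (\<lambda>y. of_real (w y powr s) * f y) x * cnj (of_real (v x powr s) * g x)) \<le> 1"
proof -
  define F where "F = (\<lambda>z x. complex_of_real (w x) powr z * f x)"
  define G where "G = (\<lambda>z x. complex_of_real (v x) powr z * g x)"
  \<comment> \<open>The inner conjugation of \<open>z\<close> cancels the conjugation in the scalar
    product, which makes the expression holomorphic rather than antiholomorphic in the second
    weight.\<close>
  define \<phi> where "\<phi> = (\<lambda>z. LINT x|M. U (F z) x * cnj (G (cnj z) x))"
  have F: "F z \<in> Lp_space 2 M" and G: "G z \<in> Lp_space 2 M" for z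
    unfolding F_def G_def using f g w v
    by (auto intro!: Lp_space_2_mult_simple simple_function_of_real_powr)
  have norm_F: "norm (F z x) = w x powr Re z * norm (f x)"
    and norm_G: "norm (G z x) = v x powr Re z * norm (g x)" for z x
    using w v by (auto simp: F_def G_def norm_mult norm_of_real_powr)

  define C where "C = w ` space M"
  define D where "D = v ` space M"
  have fin: "finite C" "finite D" using w v by (auto simp: C_def D_def simple_function_def)
  have nonneg: "c \<in> C \<Longrightarrow> 0 \<le> c" "d \<in> D \<Longrightarrow> 0 \<le> d" for c d using w v by (auto simp: C_def D_def)
  \<comment> \<open>The restrictions of \<open>f\<close> and \<open>g\<close> to the level sets of
    \<open>w\<close> and \<open>v\<close>: on each of them the weight is a constant power.\<close>
  define fc where "fc = (\<lambda>c x. indicator {y \<in> space M. w y = c} x * f x)"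
  define gd where "gd = (\<lambda>d x. indicator {y \<in> space M. v y = d} x * g x)"
  have fc: "fc c \<in> Lp_space 2 M" and gd: "gd d \<in> Lp_space 2 M" for c d
    unfolding fc_def gd_def using f g w v
    by (auto intro!: Lp_space_2_mult_simple simple_function_indicator
        borel_measurable_eq[of _ _ "\<lambda>_. _"] dest!: borel_measurable_simple_function)
  define B where "B = (\<lambda>c d. LINT x|M. U (fc c) x * cnj (gd d x))"
  have \<phi>_sum: "\<phi> z = (\<Sum>c\<in>C. \<Sum>d\<in>D. complex_of_real c powr z * complex_of_real d powr z * B c d)" for z
  proof -
    have Fs: "F z x = (\<Sum>c\<in>C. complex_of_real c powr z * fc c x)" if "x \<in> space M" for z x
    proof -
      have "(\<Sum>c\<in>C. complex_of_real c powr z * fc c x) = (\<Sum>c\<in>C. if c = w x then F z x else 0)"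
        using that by (intro sum.cong) (auto simp: fc_def F_def)
      also have "\<dots> = F z x" using that fin by (simp add: C_def)
      finally show ?thesis by simp
    qed
    have Gs: "G z x = (\<Sum>d\<in>D. complex_of_real d powr z * gd d x)" if "x \<in> space M" for z x
    proof -
      have "(\<Sum>d\<in>D. complex_of_real d powr z * gd d x) = (\<Sum>d\<in>D. if d = v x then G z x else 0)"
        using that by (intro sum.cong) (auto simp: gd_def G_def)
      also have "\<dots> = G z x" using that fin by (simp add: D_def)
      finally show ?thesis by simp
    qed
    have "\<phi> z = (LINT x|M. U (\<lambda>x. \<Sum>c\<in>C. complex_of_real c powr z * fc c x) x
        * cnj (\<Sum>d\<in>D. complex_of_real d powr cnj z * gd d x))"
      unfolding \<phi>_def using F G fc gd fin Fs Gs by (intro inner_cong Lp_space_2_sum) auto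
    also have "\<dots> = (\<Sum>c\<in>C. \<Sum>d\<in>D. complex_of_real c powr z * cnj (complex_of_real d powr cnj z) * B c d)"
      unfolding B_def by (intro inner_sum fin fc gd)
    also have "\<dots> = (\<Sum>c\<in>C. \<Sum>d\<in>D. complex_of_real c powr z * complex_of_real d powr z * B c d)"
      by (intro sum.cong refl) (simp add: cnj_of_real_powr nonneg)
    finally show ?thesis .
  qed
  have hol: "\<phi> holomorphic_on A" for A
    unfolding \<phi>_sum by (intro holomorphic_intros holomorphic_of_real_powr)
  \<comment> \<open>On the strip a power of \<open>c \<ge> 0\<close> has modulus
    \<open>c powr Re z\<close>, which is at most 1 or at most \<open>c\<close>, hence at most
    \<open>1 + c\<close>.\<close>
  define K where "K = (\<Sum>c\<in>C. \<Sum>d\<in>D. (1 + c) * (1 + d) * norm (B c d))"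
  have powr_le: "c powr t \<le> 1 + c" if "0 \<le> c" "0 \<le> t" "t \<le> 1" for c t :: real
  proof (cases "c \<le> 1")
    case True
    then have "c powr t \<le> 1 powr t" using that by (intro powr_mono2) auto
    then show ?thesis using that by simp
  next
    case False
    then have "c powr t \<le> c powr 1" using that by (intro powr_mono) auto
    then show ?thesis using that by simp
  qed
  have bdd: "norm (\<phi> z) \<le> K" if "0 \<le> Re z" "Re z \<le> 1" for z
    unfolding \<phi>_sum K_def
    by (intro sum_norm_le)
       (auto simp: norm_mult norm_of_real_powr nonneg intro!: mult_mono powr_le that)
  \<comment> \<open>Here the weights have modulus 1 where they are nonzero and vanish elsewhere, so
    the norms can only drop.\<close>
  have left: "norm (\<phi> z) \<le> 1" if z: "Re z = 0" for z
  proof -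
    have le: "norm (F z x) \<le> norm (f x)" "norm (G (cnj z) x) \<le> norm (g x)" for x
      using z by (auto simp: norm_F norm_G)
    have "(LINT x|M. (norm (F z x))\<^sup>2) \<le> (LINT x|M. (norm (f x))\<^sup>2)"
      using F f le by (intro integral_mono power_mono) (auto simp: Lp_space_2_iff)
    moreover have "(LINT x|M. (norm (G (cnj z) x))\<^sup>2) \<le> (LINT x|M. (norm (g x))\<^sup>2)"
      using G g le by (intro integral_mono power_mono) (auto simp: Lp_space_2_iff)
    ultimately show ?thesis
      unfolding \<phi>_def using F G f g by (intro norm_inner_le_1_of_L2) auto
  qed
  \<comment> \<open>Here the weighted functions have modulus \<open>w x * norm (f x)\<close> and
    \<open>v x * norm (g x)\<close>, so \<open>w x \<le> norm (f x)\<close> and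
    \<open>v x \<le> norm (g x)\<close> give integrable majorants of integral at most 1.\<close>
  have right: "norm (\<phi> z) \<le> 1" if z: "Re z = 1" for z
  proof -
    have le: "norm (F z x) \<le> (norm (f x))\<^sup>2" "norm (G (cnj z) x) \<le> (norm (g x))\<^sup>2" for x
      using z w v by (auto simp: norm_F norm_G power2_eq_square intro!: mult_right_mono)
    have intF: "integrable M (F z)"
      using F f le by (intro Bochner_Integration.integrable_bound[of M "\<lambda>x. (norm (f x))\<^sup>2" "F z"])
        (auto simp: Lp_space_2_iff)
    have intG: "integrable M (G (cnj z))"
      using G g le by (intro Bochner_Integration.integrable_bound[of M "\<lambda>x. (norm (g x))\<^sup>2" "G (cnj z)"])
        (auto simp: Lp_space_2_iff)
    have "(LINT x|M. norm (F z x)) \<le> (LINT x|M. (norm (f x))\<^sup>2)"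
      "(LINT x|M. norm (G (cnj z) x)) \<le> (LINT x|M. (norm (g x))\<^sup>2)"
      using intF intG f g le by (auto simp: Lp_space_2_iff intro!: integral_mono integrable_norm)
    then show ?thesis
      unfolding \<phi>_def using F G f g intF intG by (intro norm_inner_le_1_of_L1) auto
  qed
  have "norm (\<phi> (of_real s)) \<le> 1"
    using hol s by (intro three_lines_bound[OF _ _ bdd left right] holomorphic_on_imp_continuous_on) auto
  then show ?thesis using w(2) v(2) by (simp add: \<phi>_def F_def G_def powr_of_real)
qed

end

section \<open>Difference quotients of powers at exponent 0\<close>

text \<open>The linear term is the first-order change of the pairing when a weight is raised to the
  power \<open>s\<close>. The subtracted half square pays for that weight's share of the cross
  term.\<close>

abbreviation powr_defect :: "real \<Rightarrow> real \<Rightarrow> real" where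
  "powr_defect s u \<equiv> (u powr s - 1) - (u powr s - 1)\<^sup>2 / 2"

text \<open>A bound uniform in \<open>s\<close>, as dominated convergence requires: with
  \<open>y = u powr s\<close> the defect is controlled by \<open>ln y = s * ln u\<close>, and the
  factor \<open>s\<close> cancels.\<close>

lemma powr_defect_bound:
  fixes u C s :: real
  assumes u: "0 < u" "u \<le> C" and C: "1 \<le> C" and s: "0 < s" "s \<le> 1"
  shows "\<bar>powr_defect s u\<bar> / s \<le> C * (3 + C) * \<bar>ln u\<bar>"
proof -
  define y where "y = u powr s"
  have y: "0 < y" using u by (simp add: y_def)
  have "y \<le> C powr s" using u s by (auto simp: y_def intro!: powr_mono2)
  also have "\<dots> \<le> C" using powr_mono[of s 1 C] C s by simp
  finally have yC: "y \<le> C" .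
  have ln_y: "ln y = s * ln u" using u by (simp add: y_def ln_powr)
  \<comment> \<open>For \<open>y \<le> 1\<close> this is \<open>ln y \<le> y - 1\<close>. For larger
    \<open>y\<close> the same inequality at \<open>1 / y\<close> costs a factor \<open>y\<close>,
    which is at most \<open>C\<close>.\<close>
  have "\<bar>y - 1\<bar> \<le> C * \<bar>ln y\<bar>"
  proof (cases "y \<le> 1")
    case True
    then have "\<bar>y - 1\<bar> \<le> \<bar>ln y\<bar>" using ln_le_minus_one[OF y] by simp
    also have "\<dots> \<le> C * \<bar>ln y\<bar>" using C by (simp add: mult_le_cancel_right1)
    finally show ?thesis .
  next
    case False
    have "1 - 1 / y \<le> ln y" using ln_le_minus_one[of "1 / y"] y by (simp add: ln_div)
    then have "y - 1 \<le> y * ln y" using y by (simp add: field_simps)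
    also have "\<dots> \<le> C * ln y" using yC False by (intro mult_right_mono) auto
    finally show ?thesis using False by simp
  qed
  then have *: "\<bar>y - 1\<bar> \<le> s * (C * \<bar>ln u\<bar>)" using s by (simp add: ln_y abs_mult mult_ac)
  \<comment> \<open>The defect factors as \<open>(y - 1) * (3 - y) / 2\<close>, and
    \<open>0 < y \<le> C\<close> bounds the second factor by \<open>3 + C\<close>.\<close>
  have "\<bar>(y - 1) - (y - 1)\<^sup>2 / 2\<bar> = \<bar>y - 1\<bar> * \<bar>(3 - y) / 2\<bar>"
    by (simp add: power2_eq_square field_simps flip: abs_mult)
  also have "\<dots> \<le> (s * (C * \<bar>ln u\<bar>)) * (3 + C)"
    using * y yC by (intro mult_mono) auto
  finally show ?thesis using s by (simp add: y_def field_simps)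
qed

text \<open>The defect vanishes at \<open>s = 0\<close>, so its quotient by \<open>s\<close> tends
  to its derivative there; the square is of second order and contributes nothing.\<close>

lemma powr_defect_tendsto:
  fixes u :: real
  assumes "0 < u"
  shows "(\<lambda>i. powr_defect (1 / real (Suc i)) u / (1 / real (Suc i)))
    \<longlonglongrightarrow> ln u"
proof -
  have "((\<lambda>s. powr_defect s u) has_real_derivative ln u) (at 0)"
    using assms by (auto intro!: derivative_eq_intros)
  then have "((\<lambda>h. powr_defect h u / h) \<longlongrightarrow> ln u) (at 0)"
    using assms by (simp add: DERIV_def)
  moreover have "filterlim (\<lambda>i. 1 / real (Suc i)) (at 0) sequentially"
    using LIMSEQ_inverse_real_of_nat by (auto simp: filterlim_at inverse_eq_divide)
  ultimately show ?thesis by (rule filterlim_compose)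
qed

lemma abs_ln_min_le:
  fixes t C :: real
  assumes "0 < t" "1 \<le> C"
  shows "\<bar>ln (min t C)\<bar> \<le> max 0 (- ln t) + ln C"
  using assms by (cases "t \<le> C"; cases "t \<le> 1") (auto simp: min_def)

section \<open>The first-order inequality for simple weights\<close>

context unitary_L1_contraction
begin

text \<open>Expand the interpolated pairing around \<open>s = 0\<close>; the cross term is estimated by the mean of
  the squared norms of the two increments, which is of second order in \<open>s\<close>.\<close>

lemma simple_entropy_increment:
  fixes w v :: "'a \<Rightarrow> real"
  assumes f: "f \<in> Lp_space 2 M" "(LINT x|M. (norm (f x))\<^sup>2) = 1"
    and w: "simple_function M w" "\<And>x. 0 \<le> w x" "\<And>x. w x \<le> norm (f x)"
    and v: "simple_function M v" "\<And>x. 0 \<le> v x" "\<And>x. v x \<le> norm (U f x)"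
    and s: "0 \<le> s" "s \<le> 1"
  shows "(LINT x|M. (norm (f x))\<^sup>2 * powr_defect s (w x))
    + (LINT x|M. (norm (U f x))\<^sup>2 * powr_defect s (v x)) \<le> 0"
proof -
  define g where "g = U f"
  have g: "g \<in> Lp_space 2 M" "(LINT x|M. (norm (g x))\<^sup>2) = 1"
    using closed[OF f(1)] norm_eq[OF f(1)] f(2) by (auto simp: g_def)
  define p where "p = (\<lambda>x. complex_of_real (w x powr s - 1) * f x)"
  define q where "q = (\<lambda>x. complex_of_real (v x powr s - 1) * g x)"
  have p: "p \<in> Lp_space 2 M" and q: "q \<in> Lp_space 2 M"
    unfolding p_def q_def using f g w v
    by (auto intro: Lp_space_2_mult_simple_compose[where b = "\<lambda>c. c powr s - 1"] simp del: of_real_diff)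
  have Up: "U p \<in> Lp_space 2 M" using p by (rule closed)
  note int = integrable_Lp_space_2_mult
  \<comment> \<open>The weighted functions are \<open>f + p\<close> and \<open>g + q\<close>, so the
    pairing splits into four terms.\<close>
  have "(LINT x|M. U (\<lambda>y. of_real (w y powr s) * f y) x * cnj (of_real (v x powr s) * g x))
    = (LINT x|M. g x * cnj (g x) + g x * cnj (q x) + U p x * cnj (g x) + U p x * cnj (q x))"
  proof (rule integral_cong_AE)
    have "AE x in M. U (\<lambda>y. 1 * f y + 1 * p y) x = 1 * U f x + 1 * U p x"
      using f p by (intro linear) auto
    moreover have "(\<lambda>y. 1 * f y + 1 * p y) = (\<lambda>y. of_real (w y powr s) * f y)"
      by (auto simp: p_def algebra_simps)
    ultimately have "AE x in M. U (\<lambda>y. of_real (w y powr s) * f y) x = g x + U p x"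
      by (simp add: g_def)
    then show "AE x in M. U (\<lambda>y. of_real (w y powr s) * f y) x * cnj (of_real (v x powr s) * g x)
      = g x * cnj (g x) + g x * cnj (q x) + U p x * cnj (g x) + U p x * cnj (q x)"
      by eventually_elim (simp add: q_def algebra_simps)
    have 1: "(\<lambda>y. of_real (w y powr s) * f y) \<in> Lp_space 2 M" "(\<lambda>y. of_real (v y powr s) * g y) \<in> Lp_space 2 M"
      using f g w v by (auto intro: Lp_space_2_mult_simple_compose[where b = "\<lambda>c. c powr s"])
    show "(\<lambda>x. U (\<lambda>y. of_real (w y powr s) * f y) x * cnj (of_real (v x powr s) * g x)) \<in> borel_measurable M"
      using int[OF closed[OF 1(1)] 1(2)] by (rule borel_measurable_integrable)
    show "(\<lambda>x. g x * cnj (g x) + g x * cnj (q x) + U p x * cnj (g x) + U p x * cnj (q x)) \<in> borel_measurable M"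
      by (intro borel_measurable_add borel_measurable_integrable int g q Up)
  qed
  also have "\<dots> = (LINT x|M. g x * cnj (g x)) + (LINT x|M. g x * cnj (q x))
      + (LINT x|M. U p x * cnj (g x)) + (LINT x|M. U p x * cnj (q x))"
    by (subst Bochner_Integration.integral_add
      | intro Bochner_Integration.integrable_add int g q Up refl)+
  also have "(LINT x|M. g x * cnj (g x)) = of_real (LINT x|M. (norm (g x))\<^sup>2)"
    by (simp add: complex_norm_square flip: integral_complex_of_real del: of_real_power)
  also have "(LINT x|M. g x * cnj (q x)) = of_real (LINT x|M. (norm (g x))\<^sup>2 * (v x powr s - 1))"
    by (simp add: q_def complex_norm_square mult_ac flip: integral_complex_of_real del: of_real_power)
  \<comment> \<open>Since \<open>g = U f\<close>, unitarity moves this term to the side of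
    \<open>f\<close>, where it is real.\<close>
  also have "(LINT x|M. U p x * cnj (g x)) = (LINT x|M. p x * cnj (f x))"
    unfolding g_def using p f by (intro inner_eq) auto
  also have "\<dots> = of_real (LINT x|M. (norm (f x))\<^sup>2 * (w x powr s - 1))"
    by (simp add: p_def complex_norm_square mult_ac flip: integral_complex_of_real del: of_real_power)
  finally have expand: "(LINT x|M. U (\<lambda>y. of_real (w y powr s) * f y) x * cnj (of_real (v x powr s) * g x))
    = of_real (1 + (LINT x|M. (norm (g x))\<^sup>2 * (v x powr s - 1)) + (LINT x|M. (norm (f x))\<^sup>2 * (w x powr s - 1)))
      + (LINT x|M. U p x * cnj (q x))"
    by (simp add: g)
  have "norm (LINT x|M. U (\<lambda>y. of_real (w y powr s) * f y) x * cnj (of_real (v x powr s) * g x)) \<le> 1"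
    using f g w v s by (intro interpolated_pairing) (auto simp: g_def)
  then have "Re (LINT x|M. U (\<lambda>y. of_real (w y powr s) * f y) x * cnj (of_real (v x powr s) * g x)) \<le> 1"
    using complex_Re_le_cmod order_trans by blast
  \<comment> \<open>The cross term: \<open>U p\<close> has the same norm as \<open>p\<close>, so
    only the two increments enter.\<close>
  moreover have "- Re (LINT x|M. U p x * cnj (q x))
      \<le> ((LINT x|M. (norm (p x))\<^sup>2) + (LINT x|M. (norm (q x))\<^sup>2)) / 2"
    using norm_inner_le_half_squares[OF Up q] unfolding norm_eq[OF p]
    by (rule order_trans[OF order_trans[OF abs_ge_minus_self abs_Re_le_cmod]])
  moreover have "(norm (p x))\<^sup>2 = (norm (f x))\<^sup>2 * (w x powr s - 1)\<^sup>2"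
    "(norm (q x))\<^sup>2 = (norm (g x))\<^sup>2 * (v x powr s - 1)\<^sup>2" for x
    by (simp_all add: p_def q_def norm_mult power_mult_distrib mult.commute del: of_real_diff)
  moreover have "(LINT x|M. (norm (h x))\<^sup>2 * powr_defect s (b x))
      = (LINT x|M. (norm (h x))\<^sup>2 * (b x powr s - 1)) - (LINT x|M. (norm (h x))\<^sup>2 * (b x powr s - 1)\<^sup>2) / 2"
    if "h \<in> Lp_space 2 M" "simple_function M b" for h b
  proof -
    have "integrable M (\<lambda>x. (norm (h x))\<^sup>2 * (b x powr s - 1))"
      "integrable M (\<lambda>x. (norm (h x))\<^sup>2 * (b x powr s - 1)\<^sup>2 / 2)"
      using integrable_norm_square_mult_simple[OF that, of "\<lambda>c. c powr s - 1"]
        integrable_norm_square_mult_simple[OF that, of "\<lambda>c. (c powr s - 1)\<^sup>2"] by auto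
    then show ?thesis
      by (subst integral_divide_zero[symmetric], subst Bochner_Integration.integral_diff[symmetric])
        (simp_all add: right_diff_distrib)
  qed
  ultimately show ?thesis
    using f(1) g(1) w(1) v(1) unfolding expand by (simp add: g_def)
qed

end

section \<open>Passage to truncated moduli and to exponent 0\<close>

text \<open>For fixed \<open>s\<close> the powers lie in \<open>[0, C]\<close>, so the defect is
  bounded by a constant depending only on \<open>C\<close>, and a multiple of
  \<open>(norm (f x))\<^sup>2\<close> dominates.\<close>

lemma tendsto_integral_powr_defect:
  fixes w :: "nat \<Rightarrow> 'a \<Rightarrow> real"
  assumes f: "f \<in> Lp_space 2 M"
    and w: "\<And>i. w i \<in> borel_measurable M" "\<And>i x. 0 \<le> w i x" "\<And>i x. w i x \<le> C"
    and lim: "\<And>x. (\<lambda>i. w i x) \<longlonglongrightarrow> u x"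
    and C: "1 \<le> C" and s: "0 < s" "s \<le> 1"
  shows "(\<lambda>i. LINT x|M. (norm (f x))\<^sup>2 * powr_defect s (w i x))
    \<longlonglongrightarrow> (LINT x|M. (norm (f x))\<^sup>2 * powr_defect s (u x))"
proof (rule integral_dominated_convergence)
  have [measurable]: "f \<in> borel_measurable M" "w i \<in> borel_measurable M" for i
    using f w by (auto simp: Lp_space_2_iff)
  have [measurable]: "u \<in> borel_measurable M"
    using lim w(1) by (intro borel_measurable_LIMSEQ_real[of M w u]) auto
  show "(\<lambda>x. (norm (f x))\<^sup>2 * powr_defect s (u x)) \<in> borel_measurable M"
    "(\<lambda>x. (norm (f x))\<^sup>2 * powr_defect s (w i x)) \<in> borel_measurable M" for i
    by measurable
  show "integrable M (\<lambda>x. (norm (f x))\<^sup>2 * ((1 + C) + (1 + C)\<^sup>2))"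
    using f by (simp add: Lp_space_2_iff)
  \<comment> \<open>The exponent must be strictly positive: only then is \<open>powr\<close>
    continuous at base 0.\<close>
  show "AE x in M. (\<lambda>i. (norm (f x))\<^sup>2 * powr_defect s (w i x))
    \<longlonglongrightarrow> (norm (f x))\<^sup>2 * powr_defect s (u x)"
    using s w(2) by (intro AE_I2 tendsto_intros tendsto_powr' lim) auto
  show "AE x in M. norm ((norm (f x))\<^sup>2 * powr_defect s (w i x))
    \<le> (norm (f x))\<^sup>2 * ((1 + C) + (1 + C)\<^sup>2)" for i
  proof (rule AE_I2)
    fix x
    have "w i x powr s \<le> C powr s" using w s by (intro powr_mono2) auto
    also have "\<dots> \<le> C" using powr_mono[of s 1 C] C s by simp
    finally have y: "\<bar>w i x powr s - 1\<bar> \<le> 1 + C" by (simp add: abs_le_iff) (smt (verit) powr_ge_zero C)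
    have "(w i x powr s - 1)\<^sup>2 \<le> (1 + C)\<^sup>2" using y by (metis abs_ge_zero power2_abs power_mono)
    then have "\<bar>powr_defect s (w i x)\<bar> \<le> (1 + C) + (1 + C)\<^sup>2"
      using y zero_le_power2[of "w i x powr s - 1"] by linarith
    then show "norm ((norm (f x))\<^sup>2 * powr_defect s (w i x))
      \<le> (norm (f x))\<^sup>2 * ((1 + C) + (1 + C)\<^sup>2)"
      by (simp add: abs_mult mult_left_mono)
  qed
qed

text \<open>Dominated convergence along \<open>s = 1 / Suc i\<close>. Large values of
  \<open>norm (f x)\<close> are harmless by truncation, and small ones, where the logarithm is
  unbounded, are controlled by \<open>tail\<close>.\<close>

lemma truncated_entropy_limit:
  assumes f: "f \<in> Lp_space 2 M"
    and tail: "integrable M (\<lambda>x. (norm (f x))\<^sup>2 * max 0 (- ln (norm (f x))))"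
    and C: "1 \<le> C"
  shows "integrable M (\<lambda>x. (norm (f x))\<^sup>2 * ln (min (norm (f x)) C))" (is ?integrable)
    and "(\<lambda>i. (LINT x|M. (norm (f x))\<^sup>2 * powr_defect (1 / real (Suc i)) (min (norm (f x)) C)) / (1 / real (Suc i)))
    \<longlonglongrightarrow> (LINT x|M. (norm (f x))\<^sup>2 * ln (min (norm (f x)) C))" (is ?limit)
proof -
  have [measurable]: "f \<in> borel_measurable M" using f by (simp add: Lp_space_2_iff)
  define B where "B = (\<lambda>x. (norm (f x))\<^sup>2 * (max 0 (- ln (norm (f x))) + ln C))"
  have "integrable M (\<lambda>x. (norm (f x))\<^sup>2 * max 0 (- ln (norm (f x))) + (norm (f x))\<^sup>2 * ln C)"
    using f tail by (intro Bochner_Integration.integrable_add) (auto simp: Lp_space_2_iff)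
  then have B: "integrable M B" by (simp add: B_def distrib_left)
  have ln_le: "(norm (f x))\<^sup>2 * \<bar>ln (min (norm (f x)) C)\<bar> \<le> B x" for x
    using abs_ln_min_le[of "norm (f x)" C] C by (cases "f x = 0") (auto simp: B_def intro!: mult_left_mono)
  show ?integrable
    by (intro Bochner_Integration.integrable_bound[OF B])
      (auto simp: abs_mult intro!: order_trans[OF ln_le abs_ge_self])
  have "(\<lambda>i. LINT x|M. (norm (f x))\<^sup>2 * (powr_defect (1 / real (Suc i)) (min (norm (f x)) C) / (1 / real (Suc i))))
    \<longlonglongrightarrow> (LINT x|M. (norm (f x))\<^sup>2 * ln (min (norm (f x)) C))"
  proof (rule integral_dominated_convergence)
    show "integrable M (\<lambda>x. C * (3 + C) * B x)" using B by simp
    show "AE x in M. (\<lambda>i. (norm (f x))\<^sup>2 * (powr_defect (1 / real (Suc i)) (min (norm (f x)) C) / (1 / real (Suc i))))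
      \<longlonglongrightarrow> (norm (f x))\<^sup>2 * ln (min (norm (f x)) C)"
    proof (rule AE_I2)
      fix x
      show "(\<lambda>i. (norm (f x))\<^sup>2 * (powr_defect (1 / real (Suc i)) (min (norm (f x)) C) / (1 / real (Suc i))))
        \<longlonglongrightarrow> (norm (f x))\<^sup>2 * ln (min (norm (f x)) C)"
      \<comment> \<open>Where \<open>f\<close> vanishes the factor
        \<open>(norm (f x))\<^sup>2\<close> makes both sides 0; elsewhere the truncated modulus is
        positive.\<close>
      proof (cases "f x = 0")
        case False
        then show ?thesis using C by (intro tendsto_mult_left powr_defect_tendsto) auto
      qed simp
    qed
    show "AE x in M. norm ((norm (f x))\<^sup>2 * (powr_defect (1 / real (Suc i)) (min (norm (f x)) C) / (1 / real (Suc i))))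
      \<le> C * (3 + C) * B x" for i
    proof (rule AE_I2)
      fix x
      show "norm ((norm (f x))\<^sup>2 * (powr_defect (1 / real (Suc i)) (min (norm (f x)) C) / (1 / real (Suc i))))
        \<le> C * (3 + C) * B x"
      proof (cases "f x = 0")
        case True
        then show ?thesis by (simp add: B_def)
      next
        case False
        have "\<bar>powr_defect (1 / real (Suc i)) (min (norm (f x)) C)\<bar> / (1 / real (Suc i))
          \<le> C * (3 + C) * \<bar>ln (min (norm (f x)) C)\<bar>"
          using False C by (intro powr_defect_bound) auto
        then have "(norm (f x))\<^sup>2 * (\<bar>powr_defect (1 / real (Suc i)) (min (norm (f x)) C)\<bar> / (1 / real (Suc i)))
          \<le> (norm (f x))\<^sup>2 * (C * (3 + C) * \<bar>ln (min (norm (f x)) C)\<bar>)"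
          by (intro mult_left_mono) auto
        also have "\<dots> = C * (3 + C) * ((norm (f x))\<^sup>2 * \<bar>ln (min (norm (f x)) C)\<bar>)"
          by simp
        also have "\<dots> \<le> C * (3 + C) * B x"
          using ln_le C by (intro mult_left_mono) auto
        finally show ?thesis by (simp add: abs_mult)
      qed
    qed
  qed measurable
  then show ?limit by (simp only: times_divide_eq_right integral_divide_zero)
qed

section \<open>Positive and negative parts of the entropy\<close>

lemma ennreal_minus_mult_ln:
  fixes b t :: real
  assumes "0 \<le> b"
  shows "ennreal (- (b * t)) = ennreal (b * max 0 (- t))"
  using assms by (cases "t \<le> 0") (auto simp: max_def ennreal_neg mult_nonneg_nonneg)

lemma ln_norm_square: "ln \<bar>(norm z)\<^sup>2\<bar> * \<bar>(norm z)\<^sup>2\<bar> = 2 * (norm z)\<^sup>2 * ln (norm z)"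
  by (cases "norm z = 0") (auto simp: ln_realpow)

lemma integrable_tail_of_entropy_pos:
  assumes f: "f \<in> Lp_space 2 M" and fin: "entropy_pos M (\<lambda>x. (norm (f x))\<^sup>2) < \<infinity>"
  shows "integrable M (\<lambda>x. (norm (f x))\<^sup>2 * max 0 (- ln (norm (f x))))"
proof -
  have [measurable]: "f \<in> borel_measurable M" using f by (simp add: Lp_space_2_iff)
  have "integrable M (\<lambda>x. 2 * (norm (f x))\<^sup>2 * max 0 (- ln (norm (f x))))"
    using fin unfolding entropy_pos_def ln_norm_square
    by (intro integrableI_nonneg) (auto simp: ennreal_minus_mult_ln)
  then show ?thesis by (simp add: mult.assoc)
qed

text \<open>Truncation at \<open>C \<ge> 1\<close> changes the logarithm only where it is positive.
  The part of the integral where it is negative is therefore \<open>entropy_pos\<close>,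
  independently of \<open>C\<close>; the factor 2 comes from the logarithm of a square.\<close>

lemma truncated_entropy_decomposition:
  assumes f: "f \<in> Lp_space 2 M" and fin: "entropy_pos M (\<lambda>x. (norm (f x))\<^sup>2) < \<infinity>"
    and C: "1 \<le> C"
  shows "(\<integral>\<^sup>+x. ennreal (2 * (norm (f x))\<^sup>2 * ln (min (norm (f x)) C)) \<partial>M) < \<infinity>" (is "?N < _")
    and "2 * (LINT x|M. (norm (f x))\<^sup>2 * ln (min (norm (f x)) C))
      = enn2real (\<integral>\<^sup>+x. ennreal (2 * (norm (f x))\<^sup>2 * ln (min (norm (f x)) C)) \<partial>M)
        - enn2real (entropy_pos M (\<lambda>x. (norm (f x))\<^sup>2))"
proof -
  have int: "integrable M (\<lambda>x. 2 * (norm (f x))\<^sup>2 * ln (min (norm (f x)) C))"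
    using truncated_entropy_limit(1)[OF f integrable_tail_of_entropy_pos[OF f fin] C]
    by (simp add: mult.assoc)
  then show "?N < \<infinity>" by (auto simp: real_integrable_def top.not_eq_extremum)
  have "ennreal (- (2 * (norm z)\<^sup>2 * ln (min (norm z) C))) = ennreal (- (2 * (norm z)\<^sup>2 * ln (norm z)))"
    for z :: complex
  proof -
    have "2 * (norm z)\<^sup>2 * max 0 (- ln (min (norm z) C)) = 2 * (norm z)\<^sup>2 * max 0 (- ln (norm z))"
      using C by (cases "z = 0"; cases "norm z \<le> C") (auto simp: min_def)
    moreover have "0 \<le> 2 * (norm z)\<^sup>2" by simp
    ultimately show ?thesis by (simp only: ennreal_minus_mult_ln)
  qed
  then have "(\<integral>\<^sup>+x. ennreal (- (2 * (norm (f x))\<^sup>2 * ln (min (norm (f x)) C))) \<partial>M)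
      = entropy_pos M (\<lambda>x. (norm (f x))\<^sup>2)"
    by (simp only: entropy_pos_def ln_norm_square)
  then show "2 * (LINT x|M. (norm (f x))\<^sup>2 * ln (min (norm (f x)) C))
      = enn2real ?N - enn2real (entropy_pos M (\<lambda>x. (norm (f x))\<^sup>2))"
    using real_lebesgue_integral_def[OF int] by (simp add: mult.assoc)
qed

text \<open>Monotone convergence in the truncation level. Levels \<open>Suc n\<close> are at least
  1, as the decomposition above requires.\<close>

lemma
  assumes f: "f \<in> borel_measurable M"
  shows incseq_truncated_entropy: 
      "incseq (\<lambda>n. \<integral>\<^sup>+x. ennreal (2 * (norm (f x))\<^sup>2 * ln (min (norm (f x)) (real (Suc n)))) \<partial>M)"
    and entropy_neg_eq_SUP: "entropy_neg M (\<lambda>x. (norm (f x))\<^sup>2)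
      = (SUP n. \<integral>\<^sup>+x. ennreal (2 * (norm (f x))\<^sup>2 * ln (min (norm (f x)) (real (Suc n)))) \<partial>M)"
proof -
  note [measurable] = f
  have inc: "ln (min t (real (Suc m))) \<le> ln (min t (real (Suc n)))" if "m \<le> n" "0 < t" for m n and t :: real
    using that by auto
  have mono: "ennreal (2 * (norm (f x))\<^sup>2 * ln (min (norm (f x)) (real (Suc m))))
    \<le> ennreal (2 * (norm (f x))\<^sup>2 * ln (min (norm (f x)) (real (Suc n))))" if "m \<le> n" for m n x
    using inc[OF that, of "norm (f x)"] by (cases "f x = 0") (auto intro!: ennreal_leI mult_left_mono)
  show "incseq (\<lambda>n. \<integral>\<^sup>+x. ennreal (2 * (norm (f x))\<^sup>2 * ln (min (norm (f x)) (real (Suc n)))) \<partial>M)"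
    by (auto simp: incseq_def simp del: of_nat_Suc intro!: nn_integral_mono mono)
  have "(SUP n. ennreal (2 * (norm (f x))\<^sup>2 * ln (min (norm (f x)) (real (Suc n)))))
      = ennreal (ln \<bar>(norm (f x))\<^sup>2\<bar> * \<bar>(norm (f x))\<^sup>2\<bar>)" (is "(SUP n. ?T n) = ?L") for x
  proof (cases "f x = 0")
    case False
    have L: "?L = ennreal (2 * (norm (f x))\<^sup>2 * ln (norm (f x)))"
      by (simp only: ln_norm_square)
    \<comment> \<open>At each point the supremum is attained as soon as the level exceeds
      \<open>norm (f x)\<close>.\<close>
    obtain n where n: "norm (f x) \<le> real (Suc n)" by (metis real_arch_simple le_SucI of_nat_le_iff order_trans le_refl)
    have "?T m \<le> ?L" for m
      unfolding L using False by (intro ennreal_leI mult_left_mono) auto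
    moreover have "?L = ?T n" using n unfolding L by (simp add: min_absorb1)
    ultimately show ?thesis by (intro antisym SUP_least) (auto intro: SUP_upper)
  qed simp
  then have "entropy_neg M (\<lambda>x. (norm (f x))\<^sup>2)
    = (\<integral>\<^sup>+x. (SUP n. ennreal (2 * (norm (f x))\<^sup>2 * ln (min (norm (f x)) (real (Suc n))))) \<partial>M)"
    by (simp only: entropy_neg_def)
  also have "\<dots> = (SUP n. \<integral>\<^sup>+x. ennreal (2 * (norm (f x))\<^sup>2 * ln (min (norm (f x)) (real (Suc n)))) \<partial>M)"
    by (intro nn_integral_monotone_convergence_SUP) (auto simp: incseq_def le_fun_def mono simp del: of_nat_Suc)
  finally show "entropy_neg M (\<lambda>x. (norm (f x))\<^sup>2)
      = (SUP n. \<integral>\<^sup>+x. ennreal (2 * (norm (f x))\<^sup>2 * ln (min (norm (f x)) (real (Suc n)))) \<partial>M)" .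
qed

section \<open>The entropy inequality for the abstract operator\<close>

context unitary_L1_contraction
begin

text \<open>Two limits, in this order: first the simple weights converge at fixed \<open>s\<close>,
  then \<open>s\<close> tends to 0. The approximants may vanish where \<open>f\<close> does not, so
  their logarithms admit no control; those of the truncated moduli do.\<close>

lemma truncated_entropy_le:
  assumes f: "f \<in> Lp_space 2 M" "(LINT x|M. (norm (f x))\<^sup>2) = 1"
    and tail: "integrable M (\<lambda>x. (norm (f x))\<^sup>2 * max 0 (- ln (norm (f x))))"
      "integrable M (\<lambda>x. (norm (U f x))\<^sup>2 * max 0 (- ln (norm (U f x))))"
    and C: "1 \<le> C"
  shows "(LINT x|M. (norm (f x))\<^sup>2 * ln (min (norm (f x)) C))
    + (LINT x|M. (norm (U f x))\<^sup>2 * ln (min (norm (U f x)) C)) \<le> 0"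
proof -
  note g = closed[OF f(1)]
  have [measurable]: "f \<in> borel_measurable M" "U f \<in> borel_measurable M"
    using f g by (auto simp: Lp_space_2_iff)
  obtain w where w: "\<And>i. simple_function M (w i)" "\<And>i x. 0 \<le> w i x" "\<And>i x. w i x \<le> min (norm (f x)) C"
    "\<And>x. (\<lambda>i. w i x) \<longlonglongrightarrow> min (norm (f x)) C"
    by (rule simple_function_approx_real[of "\<lambda>x. min (norm (f x)) C" M]) (use C in auto)
  obtain v where v: "\<And>i. simple_function M (v i)" "\<And>i x. 0 \<le> v i x" "\<And>i x. v i x \<le> min (norm (U f x)) C"
    "\<And>x. (\<lambda>i. v i x) \<longlonglongrightarrow> min (norm (U f x)) C"
    by (rule simple_function_approx_real[of "\<lambda>x. min (norm (U f x)) C" M]) (use C in auto)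
  have step: "(LINT x|M. (norm (f x))\<^sup>2 * powr_defect s (min (norm (f x)) C))
    + (LINT x|M. (norm (U f x))\<^sup>2 * powr_defect s (min (norm (U f x)) C)) \<le> 0"
    if s: "0 < s" "s \<le> 1" for s
  proof (rule LIMSEQ_le_const2[OF tendsto_add])
    show "(\<lambda>i. LINT x|M. (norm (f x))\<^sup>2 * powr_defect s (w i x))
      \<longlonglongrightarrow> (LINT x|M. (norm (f x))\<^sup>2 * powr_defect s (min (norm (f x)) C))"
      using f w C s
      by (intro tendsto_integral_powr_defect[where C = C]) (auto intro: borel_measurable_simple_function)
    show "(\<lambda>i. LINT x|M. (norm (U f x))\<^sup>2 * powr_defect s (v i x))
      \<longlonglongrightarrow> (LINT x|M. (norm (U f x))\<^sup>2 * powr_defect s (min (norm (U f x)) C))"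
      using g v C s
      by (intro tendsto_integral_powr_defect[where C = C]) (auto intro: borel_measurable_simple_function)
    have "(LINT x|M. (norm (f x))\<^sup>2 * powr_defect s (w i x))
      + (LINT x|M. (norm (U f x))\<^sup>2 * powr_defect s (v i x)) \<le> 0" for i
      using f w v s by (intro simple_entropy_increment) auto
    then show "\<exists>N. \<forall>i\<ge>N. (LINT x|M. (norm (f x))\<^sup>2 * powr_defect s (w i x))
      + (LINT x|M. (norm (U f x))\<^sup>2 * powr_defect s (v i x)) \<le> 0"
      by blast
  qed
  show ?thesis
  proof (rule LIMSEQ_le_const2[OF tendsto_add[OF
      truncated_entropy_limit(2)[OF f(1) tail(1) C] truncated_entropy_limit(2)[OF g tail(2) C]]], intro exI allI impI)
    fix i :: nat
    show "(LINT x|M. (norm (f x))\<^sup>2 * powr_defect (1 / real (Suc i)) (min (norm (f x)) C)) / (1 / real (Suc i))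
      + (LINT x|M. (norm (U f x))\<^sup>2 * powr_defect (1 / real (Suc i)) (min (norm (U f x)) C)) / (1 / real (Suc i)) \<le> 0"
      unfolding add_divide_distrib[symmetric]
      by (rule divide_nonpos_pos[OF step]) auto
  qed
qed

text \<open>Stated in \<open>ennreal\<close> without subtraction, so that it covers possibly
  infinite \<open>entropy_neg\<close> and in fact proves it finite.\<close>

lemma entropy_neg_le_entropy_pos:
  assumes f: "f \<in> Lp_space 2 M" "(LINT x|M. (norm (f x))\<^sup>2) = 1"
    and fin: "entropy_pos M (\<lambda>x. (norm (f x))\<^sup>2) < \<infinity>" "entropy_pos M (\<lambda>x. (norm (U f x))\<^sup>2) < \<infinity>"
  shows "entropy_neg M (\<lambda>x. (norm (f x))\<^sup>2) + entropy_neg M (\<lambda>x. (norm (U f x))\<^sup>2)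
    \<le> entropy_pos M (\<lambda>x. (norm (f x))\<^sup>2) + entropy_pos M (\<lambda>x. (norm (U f x))\<^sup>2)"
proof -
  note g = closed[OF f(1)]
  have meas: "f \<in> borel_measurable M" "U f \<in> borel_measurable M"
    using f g by (auto simp: Lp_space_2_iff)
  define Pf where "Pf = entropy_pos M (\<lambda>x. (norm (f x))\<^sup>2)"
  define Pg where "Pg = entropy_pos M (\<lambda>x. (norm (U f x))\<^sup>2)"
  define Nf where "Nf = (\<lambda>n. \<integral>\<^sup>+x. ennreal (2 * (norm (f x))\<^sup>2 * ln (min (norm (f x)) (real (Suc n)))) \<partial>M)"
  define Ng where "Ng = (\<lambda>n. \<integral>\<^sup>+x. ennreal (2 * (norm (U f x))\<^sup>2 * ln (min (norm (U f x)) (real (Suc n)))) \<partial>M)"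
  have le: "Nf n + Ng n \<le> Pf + Pg" for n
  proof -
    define If where "If = (LINT x|M. (norm (f x))\<^sup>2 * ln (min (norm (f x)) (real (Suc n))))"
    define Ig where "Ig = (LINT x|M. (norm (U f x))\<^sup>2 * ln (min (norm (U f x)) (real (Suc n))))"
    have I: "If + Ig \<le> 0"
      unfolding If_def Ig_def
      using f fin g by (intro truncated_entropy_le integrable_tail_of_entropy_pos) auto
    have N: "2 * If = enn2real (Nf n) - enn2real Pf" "2 * Ig = enn2real (Ng n) - enn2real Pg"
      unfolding Nf_def Ng_def If_def Ig_def Pf_def Pg_def
      using f g fin by (intro truncated_entropy_decomposition; simp)+
    have "Nf n < \<infinity>" "Ng n < \<infinity>"
      unfolding Nf_def Ng_def using f g fin by (intro truncated_entropy_decomposition; simp)+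
    then have "Nf n + Ng n = ennreal (enn2real (Nf n) + enn2real (Ng n))" by simp
    also have "\<dots> \<le> ennreal (enn2real Pf + enn2real Pg)"
      using I N by (intro ennreal_leI) linarith
    also have "\<dots> = Pf + Pg" using fin by (simp add: Pf_def Pg_def)
    finally show ?thesis .
  qed
  have "entropy_neg M (\<lambda>x. (norm (f x))\<^sup>2) + entropy_neg M (\<lambda>x. (norm (U f x))\<^sup>2) = (SUP n. Nf n) + (SUP n. Ng n)"
    unfolding Nf_def Ng_def using meas by (simp only: entropy_neg_eq_SUP)
  \<comment> \<open>Both sequences increase, so one common truncation level suffices.\<close>
  also have "\<dots> = (SUP n. Nf n + Ng n)"
    unfolding Nf_def Ng_def using meas by (intro ennreal_SUP_add[symmetric] incseq_truncated_entropy)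
  also have "\<dots> \<le> Pf + Pg" using le by (intro SUP_least)
  finally show ?thesis by (simp add: Pf_def Pg_def)
qed

lemma entropy_sum_nonneg:
  assumes f: "f \<in> Lp_space 2 M" "(LINT x|M. (norm (f x))\<^sup>2) = 1"
    and wd: "entropy_sum_defined M (\<lambda>x. (norm (f x))\<^sup>2) (\<lambda>x. (norm (U f x))\<^sup>2)"
  shows "0 \<le> entropy M (\<lambda>x. (norm (f x))\<^sup>2) + entropy M (\<lambda>x. (norm (U f x))\<^sup>2)"
proof -
  define Pf where "Pf = entropy_pos M (\<lambda>x. (norm (f x))\<^sup>2)"
  define Pg where "Pg = entropy_pos M (\<lambda>x. (norm (U f x))\<^sup>2)"
  define Nf where "Nf = entropy_neg M (\<lambda>x. (norm (f x))\<^sup>2)"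
  define Ng where "Ng = entropy_neg M (\<lambda>x. (norm (U f x))\<^sup>2)"
  have wd: "Pf < \<infinity> \<or> Nf < \<infinity>" "Pg < \<infinity> \<or> Ng < \<infinity>"
    "\<not> (enn2ereal Pf - enn2ereal Nf = \<infinity> \<and> enn2ereal Pg - enn2ereal Ng = -\<infinity>)"
    "\<not> (enn2ereal Pf - enn2ereal Nf = -\<infinity> \<and> enn2ereal Pg - enn2ereal Ng = \<infinity>)"
    using wd by (auto simp: entropy_sum_defined_def entropy_defined_def entropy_def Pf_def Pg_def Nf_def Ng_def)
  have le: "Nf + Ng \<le> Pf + Pg" if "Pf < \<infinity>" "Pg < \<infinity>"
    using entropy_neg_le_entropy_pos[OF f] that by (simp add: Pf_def Pg_def Nf_def Ng_def)
  have "0 \<le> (enn2ereal Pf - enn2ereal Nf) + (enn2ereal Pg - enn2ereal Ng)"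
  proof (cases "Pf < \<infinity> \<and> Pg < \<infinity>")
    case True
    \<comment> \<open>All four quantities are then finite and the claim is one about real
      numbers.\<close>
    then have "Nf + Ng < \<infinity>" by (intro le_less_trans[OF le]) auto
    then obtain pf pg nf ng where r: "Pf = ennreal pf" "Pg = ennreal pg" "Nf = ennreal nf" "Ng = ennreal ng"
      "0 \<le> pf" "0 \<le> pg" "0 \<le> nf" "0 \<le> ng"
      using True by (cases Pf; cases Pg; cases Nf; cases Ng) auto
    then have "nf + ng \<le> pf + pg" using le True by (simp flip: ennreal_plus)
    then show ?thesis using r by (simp add: enn2ereal_ennreal zero_ereal_def)
  next
    case False
    \<comment> \<open>One of \<open>Pf\<close>, \<open>Pg\<close> is infinite. Its entropy is
      \<infinity> because it is defined, and the other is not -\<infinity>, so the sum is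
      \<infinity>.\<close>
    then show ?thesis using wd
      by (cases Pf; cases Pg; cases Nf; cases Ng) (auto simp: enn2ereal_ennreal)
  qed
  then show ?thesis by (simp add: entropy_def Pf_def Pg_def Nf_def Ng_def)
qed

end

section \<open>Application to the generalized Fourier transform\<close>

theorem theorem7p1:
  fixes R P :: "(real ^ 'n) set"
    and k :: "real ^ 'n \<Rightarrow> real"
    and a :: real
    and F :: "(real ^ 'n \<Rightarrow> complex) \<Rightarrow> (real ^ 'n \<Rightarrow> complex)"
    and f :: "real ^ 'n \<Rightarrow> complex"
  assumes root_system: "reduced_root_system R"
    and positive: "positive_subsystem R P"
    and multiplicity: "multiplicity_function R k"
    and a_pos: "a > 0"
    and admissible: "a + 2 * k_index P k + real CARD('n) > 2"
    and cases: "CARD('n) = 1 \<or> a \<in> {1, 2}"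
    and transform: "is_ka_fourier_transform P k a F"
    and normalization: "\<forall>h \<in> Lp_space 1 (ka_measure P k a) \<inter> Lp_space 2 (ka_measure P k a).
          esssup (ka_measure P k a) (\<lambda>x. ereal (norm (F h x))) \<le> ereal (Lp_norm 1 (ka_measure P k a) h)"
    and f_L2: "f \<in> Lp_space 2 (ka_measure P k a)"
    and f_norm: "Lp_norm 2 (ka_measure P k a) f = 1"
    and well_defined: "entropy_sum_defined (ka_measure P k a)
          (\<lambda>x. (norm (f x))\<^sup>2) (\<lambda>x. (norm (F f x))\<^sup>2)"
  shows "entropy (ka_measure P k a) (\<lambda>x. (norm (f x))\<^sup>2)
       + entropy (ka_measure P k a) (\<lambda>x. (norm (F f x))\<^sup>2) \<ge> 0"
proof -
  interpret unitary_L1_contraction "ka_measure P k a" F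
  proof
    show "unitary_on_L2 (ka_measure P k a) F"
      using transform by (simp add: is_ka_fourier_transform_def)
    fix h assume h: "h \<in> Lp_space 1 (ka_measure P k a)" "h \<in> Lp_space 2 (ka_measure P k a)"
    \<comment> \<open>The essential supremum is itself an almost everywhere upper bound, which turns
      the normalization into the pointwise form of \<open>bound\<close>.\<close>
    have "AE x in ka_measure P k a. ereal (norm (F h x)) \<le> esssup (ka_measure P k a) (\<lambda>x. ereal (norm (F h x)))"
      by (rule esssup_AE)
    then show "AE x in ka_measure P k a. norm (F h x) \<le> Lp_norm 1 (ka_measure P k a) h"
    proof eventually_elim
      case (elim x)
      then have "ereal (norm (F h x)) \<le> ereal (Lp_norm 1 (ka_measure P k a) h)"
        using normalization h by (blast intro: order_trans)
      then show ?case by simp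
    qed
  qed
  have "(LINT x|ka_measure P k a. (norm (f x))\<^sup>2) powr (1 / 2) = 1"
    using f_norm by (simp add: Lp_norm_def)
  moreover have "0 \<le> (LINT x|ka_measure P k a. (norm (f x))\<^sup>2)" by simp
  ultimately have "(LINT x|ka_measure P k a. (norm (f x))\<^sup>2) = 1"
    by (simp add: powr_half_sqrt)
  then show ?thesis using f_L2 well_defined by (intro entropy_sum_nonneg) auto
qed

end
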